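(* If $\varphi(x)$ is a candidate function (of relative degree one, so that $\varphi(x,u)\equiv\varphi(x)$), $\varphi(x(0))\ge 0$, $L_f\varphi(x)\ge 0$ for all $x\in X$, $L_g\varphi(x)=\gamma L_gL_f^{m-1}b(x)$ for all $x\in X$ for some $\gamma>0$, and $0\in U$, then any controller $u(t)\in U_s(x(t))$, for all $t\ge 0$, guarantees the feasibility of problem (P).
   Context: System: $\dot x=f(x)+g(x)u$, $x\in X\subset\mathbb R^n$, with $f:\mathbb R^n\to\mathbb R^n$ and $g:\mathbb R^n\to\mathbb R^{n\times q}$ locally Lipschitz, and $u\in U=\{u\in\mathbb R^q: u_{\min}\le u\le u_{\max}\}$ (componentwise inequalities, $u_{\min},u_{\max}\in\mathbb R^q$). $x(0)$ is the initial state and $x(t)$ the resulting solution. $L_f,L_g$ are Lie derivatives along $f,g$; for a scalar function $h$, $L_gh(x)\in\mathbb R^{1\times q}$. The relative degree of a (sufficiently many times) differentiable function with respect to the system is the number of times it must be differentiated along the dynamics until $u$ appears explicitly (zero if $u$ appears in the function itself). Class $\mathcal K$ function: continuous, strictly increasing $\alpha:[0,a)\to[0,\infty)$, $a>0$, with $\alpha(0)=0$; where such a function is evaluated at other real arguments, it is understood to be a continuous strictly increasing function on $\mathbb R$ vanishing at $0$. Safety constraint: $b(x)\ge 0$, where $b:\mathbb R^n\to\mathbb R$ has relative degree $m\ge 1$. Standing assumption: $L_gL_f^{m-1}b(x)\le 0$ (componentwise) for all $x\in X$, and no component of $L_gL_f^{m-1}b(x)$ changes sign in $[0,T]$. Set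 $\psi_0=b$ and $\psi_i=\dot\psi_{i-1}+\alpha_i(\psi_{i-1})$ for $i=1,\dots,m$, where $\alpha_i$ is an $(m-i)$th order differentiable class $\mathcal K$ function and the dot is the derivative along the system; for $i\le m-1$, $\psi_i$ depends on $x$ only. Write $S(b(x))=L_f\psi_{m-1}(x)-L_f^mb(x)$ (the remaining Lie derivatives along $f$ of degree at most $m-1$), so that $\psi_m=L_f^mb+L_gL_f^{m-1}b\,u+S(b)+\alpha_m(\psi_{m-1})$. The controls satisfying the high order control barrier function (HOCBF) constraint are $$K(x)=\{u\in\mathbb R^q: L_f^mb(x)+L_gL_f^{m-1}b(x)u+S(b(x))+\alpha_m(\psi_{m-1}(x))\ge 0\}.$$ Problem (P): minimize over $u(t),\delta(t)$ the cost $\int_0^T\left(\|u(t)\|^2+p\,\delta^2(t)\right)dt$ ($T>0$) subject to (i) $u\in K(x)$; (ii) $L_fV(x)+L_gV(x)u+\epsilon V(x)\le\delta(t)$, where $V(x)=\|x-x^\ast\|^2$ for a given target point $x^\ast\in\mathbb R^n$; (iii) $u\in U$. Here $p>0$, $\epsilon>0$, and $\delta$ is a free real relaxation variable. The problem is solved point-wise in time along the trajectory; it is feasible at a given state $x$ if the constraints (i)-(iii) at that $x$ define a non-empty set for $(u,\delta)$, and guaranteeing its feasibility means that it is feasible at the states $x(t)$ along the resulting trajectory. Define $b_{hF}(x)=L_f^mb(x)+S(b(x))+\alpha_m(\psi_{m-1}(x))+L_gL_f^{m-1}b(x)u_{\min}$ and, with a class $\mathcal K$ function $\alpha_f$, $$K_{hF}(x)=\{u\in\mathbb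 R^q: L_fb_{hF}(x)+L_gb_{hF}(x)u+\alpha_f(b_{hF}(x))\ge 0\}.$$ Let $\varphi(x,u)$ be a function such that the constraint defining $K_{hF}(x)$ is rewritten in the form $$L_f^mb(x)+L_gL_f^{m-1}b(x)u+S(b(x))+\alpha_m(\psi_{m-1}(x))+\varphi(x,u)\ge 0$$ (for example $\varphi=L_fb_{hF}+L_gb_{hF}\,u+\alpha_f(b_{hF})-L_f^mb-L_gL_f^{m-1}b\,u-S(b)-\alpha_m(\psi_{m-1})$). Such a $\varphi$ is called a candidate function if its relative degree with respect to the system is either one or zero. When the relative degree is one, $\varphi(x,u)\equiv\varphi(x)$, and with a class $\mathcal K$ function $\alpha_u$, $$U_s(x)=\{u\in\mathbb R^q: L_f\varphi(x)+L_g\varphi(x)u+\alpha_u(\varphi(x))\ge 0\}.$$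
   Formalization: The claim fails for arbitrary controllers in U_s, so two hypotheses are added: problem (P) is feasible at the initial state x(0), and the controller also satisfies the HOCBF constraint, u(t) in K(x(t)), for all t in [0,T]. *)

theory Defs
  imports "HOL-Analysis.Analysis"
begin

text \<open>Lie derivatives of a scalar function \<open>h\<close>: \<open>Lf f h x\<close> is \<open>L\<^sub>f h(x)\<close>, and \<open>Lg g h x\<close> is the
  row vector \<open>L\<^sub>g h(x)\<close>, so that \<open>L\<^sub>g h(x) u\<close> is the inner product \<open>Lg g h x \<bullet> u\<close>.\<close>

definition Lf :: "(real^'n \<Rightarrow> real^'n) \<Rightarrow> (real^'n \<Rightarrow> real) \<Rightarrow> real^'n \<Rightarrow> real"
  where "Lf f h x = frechet_derivative h (at x) (f x)"

definition Lg :: "(real^'n \<Rightarrow> real^'q^'n) \<Rightarrow> (real^'n \<Rightarrow> real) \<Rightarrow> real^'n \<Rightarrow> real^'q"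
  where "Lg g h x = (\<chi> j. frechet_derivative h (at x) (column j (g x)))"

text \<open>The exceptional set \<open>D\<close> admits controls with finitely many jumps.\<close>

definition trajectory ::
  "(real^'n \<Rightarrow> real^'n) \<Rightarrow> (real^'n \<Rightarrow> real^'q^'n) \<Rightarrow> (real^'n) set \<Rightarrow> real
    \<Rightarrow> (real \<Rightarrow> real^'q) \<Rightarrow> (real \<Rightarrow> real^'n) \<Rightarrow> bool"
  where "trajectory f g X T u x \<longleftrightarrow>
    continuous_on {0..T} x \<and> (\<forall>t\<in>{0..T}. x t \<in> X) \<and>
    (\<exists>D. finite D \<and> (\<forall>t\<in>{0..T} - D.
       (x has_vector_derivative f (x t) + g (x t) *v u t) (at t within {0..T})))"

definition locally_Lipschitz :: "('a::metric_space \<Rightarrow> 'b::metric_space) \<Rightarrow> bool"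
  where "locally_Lipschitz F \<longleftrightarrow> local_lipschitz (UNIV :: real set) UNIV (\<lambda>_. F)"

text \<open>``\<open>u\<close> appears explicitly'' is read as: its coefficient does not vanish identically on \<open>X\<close>.\<close>

definition has_relative_degree ::
  "(real^'n \<Rightarrow> real^'n) \<Rightarrow> (real^'n \<Rightarrow> real^'q^'n) \<Rightarrow> (real^'n) set
    \<Rightarrow> (real^'n \<Rightarrow> real) \<Rightarrow> nat \<Rightarrow> bool"
  where "has_relative_degree f g X h m \<longleftrightarrow> m \<ge> 1 \<and>
    (\<forall>i<m. \<forall>x. ((Lf f ^^ i) h) differentiable (at x)) \<and>
    (\<forall>i<m - 1. \<forall>x\<in>X. Lg g ((Lf f ^^ i) h) x = 0) \<and>
    (\<exists>x\<in>X. Lg g ((Lf f ^^ (m - 1)) h) x \<noteq> 0)"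

text \<open>Class \<open>\<K>\<close> functions are evaluated at arbitrary real arguments, so they are taken on all
  of the real line.\<close>

definition class_K :: "(real \<Rightarrow> real) \<Rightarrow> bool"
  where "class_K \<alpha> \<longleftrightarrow> continuous_on UNIV \<alpha> \<and> strict_mono \<alpha> \<and> \<alpha> 0 = 0"

definition times_differentiable :: "nat \<Rightarrow> (real \<Rightarrow> real) \<Rightarrow> bool"
  where "times_differentiable k \<alpha> \<longleftrightarrow> (\<forall>j<k. \<forall>s. ((deriv ^^ j) \<alpha>) differentiable (at s))"

text \<open>\<open>\<psi>\<^sub>i\<close> is only used for \<open>i \<le> m - 1\<close>, where the derivative of \<open>\<psi>\<^sub>i\<^sub>-\<^sub>1\<close> along the system does not
  depend on the control and equals \<open>L\<^sub>f \<psi>\<^sub>i\<^sub>-\<^sub>1\<close>.\<close>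

primrec psi :: "(real^'n \<Rightarrow> real^'n) \<Rightarrow> (real^'n \<Rightarrow> real) \<Rightarrow> (nat \<Rightarrow> real \<Rightarrow> real)
    \<Rightarrow> nat \<Rightarrow> real^'n \<Rightarrow> real"
  where
    "psi f b \<alpha> 0 = b"
  | "psi f b \<alpha> (Suc i) = (\<lambda>x. Lf f (psi f b \<alpha> i) x + \<alpha> (Suc i) (psi f b \<alpha> i x))"

definition S_rest :: "(real^'n \<Rightarrow> real^'n) \<Rightarrow> (real^'n \<Rightarrow> real) \<Rightarrow> (nat \<Rightarrow> real \<Rightarrow> real)
    \<Rightarrow> nat \<Rightarrow> real^'n \<Rightarrow> real"
  where "S_rest f b \<alpha> m x = Lf f (psi f b \<alpha> (m - 1)) x - (Lf f ^^ m) b x"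

definition hocbf ::
  "(real^'n \<Rightarrow> real^'n) \<Rightarrow> (real^'n \<Rightarrow> real^'q^'n) \<Rightarrow> (real^'n \<Rightarrow> real) \<Rightarrow> (nat \<Rightarrow> real \<Rightarrow> real)
    \<Rightarrow> nat \<Rightarrow> real^'n \<Rightarrow> real^'q \<Rightarrow> real"
  where "hocbf f g b \<alpha> m x u =
    (Lf f ^^ m) b x + Lg g ((Lf f ^^ (m - 1)) b) x \<bullet> u + S_rest f b \<alpha> m x
      + \<alpha> m (psi f b \<alpha> (m - 1) x)"

definition K_set ::
  "(real^'n \<Rightarrow> real^'n) \<Rightarrow> (real^'n \<Rightarrow> real^'q^'n) \<Rightarrow> (real^'n \<Rightarrow> real) \<Rightarrow> (nat \<Rightarrow> real \<Rightarrow> real)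
    \<Rightarrow> nat \<Rightarrow> real^'n \<Rightarrow> (real^'q) set"
  where "K_set f g b \<alpha> m x = {u. hocbf f g b \<alpha> m x u \<ge> 0}"

text \<open>The order on vectors is componentwise.\<close>

definition U_set :: "real^'q \<Rightarrow> real^'q \<Rightarrow> (real^'q) set"
  where "U_set umin umax = {u. umin \<le> u \<and> u \<le> umax}"

text \<open>Feasibility of the point-wise problem at the state \<open>x\<close>; the objective plays no role in it.\<close>

definition V_fun :: "real^'n \<Rightarrow> real^'n \<Rightarrow> real"
  where "V_fun xstar x = (norm (x - xstar))\<^sup>2"

definition feasible_at ::
  "(real^'n \<Rightarrow> real^'n) \<Rightarrow> (real^'n \<Rightarrow> real^'q^'n) \<Rightarrow> (real^'n \<Rightarrow> real) \<Rightarrow> (nat \<Rightarrow> real \<Rightarrow> real)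
    \<Rightarrow> nat \<Rightarrow> real^'q \<Rightarrow> real^'q \<Rightarrow> real \<Rightarrow> real^'n \<Rightarrow> real^'n \<Rightarrow> bool"
  where "feasible_at f g b \<alpha> m umin umax \<epsilon> xstar x \<longleftrightarrow>
    (\<exists>u \<delta>. u \<in> K_set f g b \<alpha> m x \<and>
       Lf f (V_fun xstar) x + Lg g (V_fun xstar) x \<bullet> u + \<epsilon> * V_fun xstar x \<le> \<delta> \<and>
       u \<in> U_set umin umax)"

definition b_hF ::
  "(real^'n \<Rightarrow> real^'n) \<Rightarrow> (real^'n \<Rightarrow> real^'q^'n) \<Rightarrow> (real^'n \<Rightarrow> real) \<Rightarrow> (nat \<Rightarrow> real \<Rightarrow> real)
    \<Rightarrow> nat \<Rightarrow> real^'q \<Rightarrow> real^'n \<Rightarrow> real"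
  where "b_hF f g b \<alpha> m umin x =
    (Lf f ^^ m) b x + S_rest f b \<alpha> m x + \<alpha> m (psi f b \<alpha> (m - 1) x)
      + Lg g ((Lf f ^^ (m - 1)) b) x \<bullet> umin"

definition cbf_set ::
  "(real^'n \<Rightarrow> real^'n) \<Rightarrow> (real^'n \<Rightarrow> real^'q^'n) \<Rightarrow> (real^'n \<Rightarrow> real) \<Rightarrow> (real \<Rightarrow> real)
    \<Rightarrow> real^'n \<Rightarrow> (real^'q) set"
  where "cbf_set f g h \<beta> x = {u. Lf f h x + Lg g h x \<bullet> u + \<beta> (h x) \<ge> 0}"

definition K_hF ::
  "(real^'n \<Rightarrow> real^'n) \<Rightarrow> (real^'n \<Rightarrow> real^'q^'n) \<Rightarrow> (real^'n \<Rightarrow> real) \<Rightarrow> (nat \<Rightarrow> real \<Rightarrow> real)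
    \<Rightarrow> nat \<Rightarrow> real^'q \<Rightarrow> (real \<Rightarrow> real) \<Rightarrow> real^'n \<Rightarrow> (real^'q) set"
  where "K_hF f g b \<alpha> m umin \<alpha>f = cbf_set f g (b_hF f g b \<alpha> m umin) \<alpha>f"

definition U_s ::
  "(real^'n \<Rightarrow> real^'n) \<Rightarrow> (real^'n \<Rightarrow> real^'q^'n) \<Rightarrow> (real^'n \<Rightarrow> real) \<Rightarrow> (real \<Rightarrow> real)
    \<Rightarrow> real^'n \<Rightarrow> (real^'q) set"
  where "U_s f g \<phi> \<alpha>u = cbf_set f g \<phi> \<alpha>u"

text \<open>The first conjunct says that the constraint defining \<open>K\<^sub>h\<^sub>F(x)\<close> can be rewritten with \<open>\<phi>\<close>, the
  second that \<open>\<phi>\<close> has relative degree zero or one.\<close>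

definition candidate_function ::
  "(real^'n \<Rightarrow> real^'n) \<Rightarrow> (real^'n \<Rightarrow> real^'q^'n) \<Rightarrow> (real^'n) set \<Rightarrow> (real^'n \<Rightarrow> real)
    \<Rightarrow> (nat \<Rightarrow> real \<Rightarrow> real) \<Rightarrow> nat \<Rightarrow> real^'q \<Rightarrow> (real \<Rightarrow> real)
    \<Rightarrow> (real^'n \<Rightarrow> real^'q \<Rightarrow> real) \<Rightarrow> bool"
  where "candidate_function f g X b \<alpha> m umin \<alpha>f \<phi> \<longleftrightarrow>
    (\<forall>x\<in>X. K_hF f g b \<alpha> m umin \<alpha>f x = {u. hocbf f g b \<alpha> m x u + \<phi> x u \<ge> 0}) \<and>
    ((\<exists>x\<in>X. \<exists>u v. \<phi> x u \<noteq> \<phi> x v) \<or>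
     (\<exists>h. \<phi> = (\<lambda>x u. h x) \<and> has_relative_degree f g X h 1))"

end

theory Submission
  imports Defs
begin

text \<open>Since \<open>L\<^sub>g L\<^sub>f\<^sup>m\<^sup>-\<^sup>1 b \<le> 0\<close>, the control \<open>umin\<close> maximises the HOCBF expression over the box, so the
  problem is feasible at a state of \<open>X\<close> exactly when \<open>b_hF \<ge> 0\<close> there. Along the trajectory,
  \<open>u \<in> U_s\<close> keeps \<open>\<phi>\<close> nonnegative by the barrier comparison argument; adding \<open>\<phi> \<ge> 0\<close> to the HOCBF
  constraint gives the constraint defining \<open>K_hF\<close>, and the same comparison argument then keeps
  \<open>b_hF\<close> nonnegative.\<close>

text \<open>The fundamental theorem of calculus tolerates a finite exceptional set once
  \<open>h\<close> is continuous, which is what controls with finitely many jumps require.\<close>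

lemma continuous_nonneg_derivative_imp_le:
  fixes h h' :: "real \<Rightarrow> real"
  assumes "a \<le> b" "finite D" "continuous_on {a..b} h"
    and deriv: "\<And>t. t \<in> {a<..<b} - D \<Longrightarrow> (h has_vector_derivative h' t) (at t)"
    and nonneg: "\<And>t. t \<in> {a<..<b} - D \<Longrightarrow> h' t \<ge> 0"
  shows "h a \<le> h b"
proof -
  \<comment> \<open>Resetting the integrand to 0 at the endpoints and on \<open>D\<close> makes it
    nonnegative on all of \<open>{a..b}\<close> without changing the integral.\<close>
  define k where "k t = (if t \<in> {a<..<b} - D then h' t else 0)" for t
  have "(k has_integral (h b - h a)) {a..b}"
    by (rule fundamental_theorem_of_calculus_interior_strong[OF \<open>finite D\<close> \<open>a \<le> b\<close>])
       (use assms in \<open>auto simp: k_def\<close>)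
  then have "0 \<le> h b - h a"
    by (rule has_integral_nonneg) (use nonneg in \<open>auto simp: k_def\<close>)
  then show ?thesis by simp
qed

text \<open>If \<open>h t < 0\<close>, let \<open>s\<close> be the last time before \<open>t\<close>
  with \<open>h s \<ge> 0\<close>. On \<open>{s<..<t}\<close> the term \<open>\<beta> (h r)\<close>
  is negative, so the barrier inequality forces \<open>h' r > 0\<close> off \<open>D\<close>; hence
  \<open>h s \<le> h t\<close>, a contradiction.\<close>

lemma barrier_nonneg:
  fixes h h' :: "real \<Rightarrow> real"
  assumes "finite D" and cont: "continuous_on {0..T} h" and "h 0 \<ge> 0"
    and deriv: "\<And>t. t \<in> {0<..<T} - D \<Longrightarrow> (h has_vector_derivative h' t) (at t)"
    and barrier: "\<And>t. t \<in> {0<..<T} - D \<Longrightarrow> h' t + \<beta> (h t) \<ge> 0"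
    and "class_K \<beta>" and t: "t \<in> {0..T}"
  shows "h t \<ge> 0"
proof (rule ccontr)
  assume neg: "\<not> h t \<ge> 0"
  define Z where "Z = {0..t} \<inter> h -` {0..}"
  have "continuous_on {0..t} h"
    using cont t by (auto intro: continuous_on_subset)
  then have "closed Z"
    unfolding Z_def by (intro continuous_closed_preimage) auto
  have "0 \<in> Z" using \<open>h 0 \<ge> 0\<close> t by (simp add: Z_def)
  have bdd: "bdd_above Z" unfolding Z_def by (auto intro: bdd_aboveI[of _ t])
  define s where "s = Sup Z"
  have "s \<in> Z"
    unfolding s_def using \<open>closed Z\<close> \<open>0 \<in> Z\<close> bdd by (intro closed_contains_Sup) auto
  then have s: "0 \<le> s" "s \<le> t" "h s \<ge> 0" by (auto simp: Z_def)
  have below: "h r < 0" if "r \<in> {s<..<t}" for r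
  proof (rule ccontr)
    assume "\<not> h r < 0"
    then have "r \<in> Z" using that s by (auto simp: Z_def)
    then have "r \<le> s" unfolding s_def using bdd by (rule cSup_upper)
    then show False using that by simp
  qed
  have "\<beta> (h r) < 0" if "r \<in> {s<..<t}" for r
    using below[OF that] \<open>class_K \<beta>\<close> strict_monoD[of \<beta> "h r" 0] by (simp add: class_K_def)
  then have "h' r \<ge> 0" if "r \<in> {s<..<t} - D" for r
    using barrier[of r] that s t by fastforce
  then have "h s \<le> h t"
    using s t by (intro continuous_nonneg_derivative_imp_le[OF _ \<open>finite D\<close>, of s t h h'])
      (auto intro: deriv continuous_on_subset[OF cont])
  then show False using s neg by simp
qed

text \<open>By linearity, with \<open>g y *v u\<close> expanded as a combination of the columns of
  \<open>g y\<close>.\<close>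

lemma frechet_derivative_control_affine:
  assumes "h differentiable (at y)"
  shows "frechet_derivative h (at y) (f y + g y *v u) = Lf f h y + Lg g h y \<bullet> u"
proof -
  interpret linear "frechet_derivative h (at y)"
    using assms by (rule linear_frechet_derivative)
  show ?thesis
    unfolding matrix_mult_sum
    by (simp add: add sum scale scalar_mult_eq_scaleR Lf_def Lg_def inner_vec_def mult.commute)
qed

text \<open>Along the trajectory, membership in \<open>cbf_set\<close> is exactly the barrier
  inequality for \<open>h\<close> composed with \<open>x\<close>. It serves below for both
  \<open>\<phi>\<close> and \<open>b_hF\<close>.\<close>

lemma cbf_set_trajectory_nonneg:
  assumes tr: "trajectory f g X T u x" and "class_K \<beta>"
    and diff: "\<forall>y\<in>X. h differentiable (at y)" and "h (x 0) \<ge> 0"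
    and cbf: "\<forall>t\<in>{0..T}. u t \<in> cbf_set f g h \<beta> (x t)" and t: "t \<in> {0..T}"
  shows "h (x t) \<ge> 0"
proof -
  from tr obtain D where D: "finite D"
    and dx: "\<And>t. t \<in> {0..T} - D \<Longrightarrow>
      (x has_vector_derivative f (x t) + g (x t) *v u t) (at t within {0..T})"
    and cx: "continuous_on {0..T} x" and xX: "\<And>t. t \<in> {0..T} \<Longrightarrow> x t \<in> X"
    unfolding trajectory_def by blast
  define h' where "h' t = Lf f h (x t) + Lg g h (x t) \<bullet> u t" for t
  have deriv: "((\<lambda>t. h (x t)) has_vector_derivative h' t) (at t)" if "t \<in> {0<..<T} - D" for t
  proof -
    have dh: "h differentiable (at (x t))" using diff xX that by auto
    have "(x has_vector_derivative f (x t) + g (x t) *v u t) (at t)"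
      using dx[of t] that at_within_Icc_at[of 0 t T] by auto
    \<comment> \<open>Restricting to \<open>range x\<close> gives the form that the vector chain
      rule expects.\<close>
    moreover have "(h has_derivative frechet_derivative h (at (x t))) (at (x t) within range x)"
      using dh by (simp add: frechet_derivative_works has_derivative_at_withinI)
    ultimately have "(h \<circ> x has_vector_derivative
        frechet_derivative h (at (x t)) (f (x t) + g (x t) *v u t)) (at t)"
      by (rule vector_derivative_diff_chain_within)
    then show ?thesis
      unfolding frechet_derivative_control_affine[OF dh] by (simp add: o_def h'_def)
  qed
  have "continuous_on X h"
    using diff by (blast intro: continuous_at_imp_continuous_on differentiable_imp_continuous_within)
  then have "continuous_on {0..T} (\<lambda>t. h (x t))"
    by (rule continuous_on_compose2[OF _ cx]) (use xX in blast)
  moreover have "h' r + \<beta> (h (x r)) \<ge> 0" if "r \<in> {0<..<T} - D" for r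
    using cbf that by (auto simp: cbf_set_def h'_def)
  ultimately show ?thesis
    using barrier_nonneg[OF D _ _ deriv _ \<open>class_K \<beta>\<close> t] \<open>h (x 0) \<ge> 0\<close> by blast
qed

text \<open>All coefficients of the control are nonpositive, so lowering each component to its bound
  can only increase the expression.\<close>

lemma hocbf_le_b_hF:
  assumes "Lg g ((Lf f ^^ (m - 1)) b) y \<le> 0" and "umin \<le> u"
  shows "hocbf f g b \<alpha> m y u \<le> b_hF f g b \<alpha> m umin y"
proof -
  have "Lg g ((Lf f ^^ (m - 1)) b) y \<bullet> u \<le> Lg g ((Lf f ^^ (m - 1)) b) y \<bullet> umin"
    using assms unfolding inner_vec_def less_eq_vec_def
    by (auto intro!: sum_mono mult_left_mono_neg)
  then show ?thesis unfolding hocbf_def b_hF_def by simp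
qed

lemma feasible_at_iff:
  assumes "Lg g ((Lf f ^^ (m - 1)) b) y \<le> 0" and "umin \<le> umax"
  shows "feasible_at f g b \<alpha> m umin umax \<epsilon> xstar y \<longleftrightarrow> b_hF f g b \<alpha> m umin y \<ge> 0"
proof
  assume "feasible_at f g b \<alpha> m umin umax \<epsilon> xstar y"
  then show "b_hF f g b \<alpha> m umin y \<ge> 0"
    using hocbf_le_b_hF[OF assms(1)] order_trans
    unfolding feasible_at_def K_set_def U_set_def by blast
next
  assume "b_hF f g b \<alpha> m umin y \<ge> 0"
  then have "umin \<in> K_set f g b \<alpha> m y"
    by (simp add: K_set_def hocbf_def b_hF_def algebra_simps)
  moreover have "umin \<in> U_set umin umax"
    using assms(2) by (simp add: U_set_def)
  \<comment> \<open>The relaxation variable is free: \<open>\<delta>\<close> can be taken equal to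
    the left-hand side of its constraint.\<close>
  ultimately show "feasible_at f g b \<alpha> m umin umax \<epsilon> xstar y"
    unfolding feasible_at_def by blast
qed

theorem theorem5:
  fixes f :: "real^'n \<Rightarrow> real^'n" and g :: "real^'n \<Rightarrow> real^'q^'n" and X :: "(real^'n) set"
    and b :: "real^'n \<Rightarrow> real" and \<alpha> :: "nat \<Rightarrow> real \<Rightarrow> real" and m :: nat
    and umin umax :: "real^'q" and \<epsilon> T \<gamma> :: real and xstar :: "real^'n"
    and \<alpha>f \<alpha>u :: "real \<Rightarrow> real" and \<phi> :: "real^'n \<Rightarrow> real"
    and u :: "real \<Rightarrow> real^'q" and x :: "real \<Rightarrow> real^'n"
  assumes "locally_Lipschitz f" and "locally_Lipschitz g"
    and "m \<ge> 1" and "has_relative_degree f g X b m"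
    and "\<forall>y\<in>X. Lg g ((Lf f ^^ (m - 1)) b) y \<le> 0"
    and "\<forall>i\<in>{1..m}. class_K (\<alpha> i) \<and> times_differentiable (m - i) (\<alpha> i)"
    and "class_K \<alpha>f" and "class_K \<alpha>u"
    and "T > 0" and "\<epsilon> > 0"
    and "\<forall>y\<in>X. b_hF f g b \<alpha> m umin differentiable (at y)"
    and "candidate_function f g X b \<alpha> m umin \<alpha>f (\<lambda>y _. \<phi> y)"
    and "\<phi> (x 0) \<ge> 0"
    and "\<forall>y\<in>X. Lf f \<phi> y \<ge> 0"
    and "\<gamma> > 0" and "\<forall>y\<in>X. Lg g \<phi> y = \<gamma> *\<^sub>R Lg g ((Lf f ^^ (m - 1)) b) y"
    and "0 \<in> U_set umin umax"
    and "trajectory f g X T u x"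
    and "\<forall>t\<in>{0..T}. u t \<in> U_s f g \<phi> \<alpha>u (x t)"
    and "feasible_at f g b \<alpha> m umin umax \<epsilon> xstar (x 0)"
    and "\<forall>t\<in>{0..T}. u t \<in> K_set f g b \<alpha> m (x t)"
  shows "\<forall>t\<in>{0..T}. feasible_at f g b \<alpha> m umin umax \<epsilon> xstar (x t)"
proof
  note Lg_nonpos = assms(5) and candidate = assms(12) and tr = assms(18)
  let ?B = "b_hF f g b \<alpha> m umin"
  fix t assume t: "t \<in> {0..T}"
  have xX: "x r \<in> X" if "r \<in> {0..T}" for r
    using tr that by (simp add: trajectory_def)
  \<comment> \<open>The origin lies between the bounds, so the box is nonempty.\<close>
  have "umin \<le> umax"
    using \<open>0 \<in> U_set umin umax\<close> by (auto simp: U_set_def intro: order_trans)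
  then have feasible_iff: "feasible_at f g b \<alpha> m umin umax \<epsilon> xstar (x r) \<longleftrightarrow> ?B (x r) \<ge> 0"
    if "r \<in> {0..T}" for r
    using feasible_at_iff Lg_nonpos xX[OF that] by blast
  \<comment> \<open>As \<open>\<phi>\<close> ignores the control, the relative-degree-zero
    alternative is impossible; the other one supplies differentiability.\<close>
  obtain h where "(\<lambda>y (_::real^'q). \<phi> y) = (\<lambda>y _. h y)" and "has_relative_degree f g X h 1"
    using candidate unfolding candidate_function_def by blast
  moreover from this have "\<phi> = h" by (metis ext)
  ultimately have "\<forall>y\<in>X. \<phi> differentiable (at y)"
    by (simp add: has_relative_degree_def)
  then have \<phi>: "\<phi> (x r) \<ge> 0" if "r \<in> {0..T}" for r
    using cbf_set_trajectory_nonneg[OF tr \<open>class_K \<alpha>u\<close>] assms(13,19) that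
    by (simp add: U_s_def)
  have "u r \<in> cbf_set f g ?B \<alpha>f (x r)" if r: "r \<in> {0..T}" for r
  proof -
    have "hocbf f g b \<alpha> m (x r) (u r) \<ge> 0"
      using assms(21) r by (simp add: K_set_def)
    \<comment> \<open>Both summands of the rewritten constraint, \<open>hocbf\<close> and
      \<open>\<phi>\<close>, are nonnegative.\<close>
    then have "u r \<in> K_hF f g b \<alpha> m umin \<alpha>f (x r)"
      using candidate \<phi>[OF r] xX[OF r] by (simp add: candidate_function_def)
    then show ?thesis by (simp add: K_hF_def)
  qed
  moreover have "?B (x 0) \<ge> 0"
    using feasible_iff[of 0] assms(20) \<open>T > 0\<close> by simp
  ultimately have "?B (x t) \<ge> 0"
    using cbf_set_trajectory_nonneg[OF tr \<open>class_K \<alpha>f\<close> assms(11)] t by blast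
  then show "feasible_at f g b \<alpha> m umin umax \<epsilon> xstar (x t)"
    using feasible_iff[OF t] by blast
qed

end
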